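(* Consider the multi-horizon stochastic program (MHSP) with subproblem value functions $g(x^O_i,q_i)$, $i\in\mathcal I$, and the stabilised adaptive Benders algorithm (the Algorithm), both as defined in the context. Suppose that $g(x^{O}_i,q_i)$ is convex with respect to the vector $x^{O}_i$ and concave with respect to the vector $q_i$, and that $g(x^{O}_i,q_i)$ is a decreasing function of the elements of $x^{O}_i$ and an increasing function of the elements of $q_i$. Then, whenever the Algorithm with convergence tolerance $\epsilon$ terminates, it has obtained an $\epsilon$-optimal solution of the MHSP.
   Context: **Problem (MHSP).** $\mathcal I$ is a finite set of strategic nodes (a rooted tree with root $1$), $A_i$ is the ancestor node of $i\neq 1$, and $\pi_i$ is the probability of node $i$ (the $\pi_i$ sum to 1 over each stage). The problem is $$\min_{\mathbf x\in\mathcal X}\ \sum_{i\in\mathcal I}\pi_i\big(c_i^\top x_i+g(x_i^O,q_i)\big)\quad\text{s.t.}\quad T^I_{A_i}x_{A_i}+W^I_ix_i\le h^I_i\ (i\in\mathcal I\setminus\{1\}),\quad W^I_1x_1\le h^I_1, \qquad (S)$$ where $\mathbf x=(x_i)_{i\in\mathcal I}$, $\mathcal X$ encodes bounds on the components of $\mathbf x$ and which of them are integer, and $x_i^O$ is the subvector of $x_i$ that affects subproblem $i$. Subproblem $i$ is the linear program $$g(x_i^O,q_i):=\min_{y_i\in\mathcal Y}\{q_i^\top Qy_i:\ T^Ox_i^O+W^Oy_i\le h^O\},$$ where $\mathcal Y$ encodes bounds on continuous variables. The matrices $Q,T^O,W^O$ and the vector $h^O$ do not depend on $i$. Subproblems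 are feasible with finite optimal value at all points considered, and the MHSP and the reduced master problems below have optimal solutions. "Increasing/decreasing" are meant componentwise and non-strictly. A point $\mathbf x\in\mathcal X$ satisfying the strategic constraints in $(S)$ is $\epsilon$-optimal if its objective value is at most the optimal value plus $\epsilon$. **Adaptive oracles.** $\mathcal S$ is a finite collection of vectors $(x_s,q_s,\theta_s,\lambda_s,\phi_s)$, where $\theta_s=g(x_s,q_s)$, $\lambda_s$ is a subgradient of $g(\cdot,q_s)$ at $x_s$, and $\phi_s$ is a supergradient of $g(x_s,\cdot)$ at $q_s$. Called at $(x,q)$, the oracles return $$\underline\theta=\max_{\mu\ge0}\Big\{\sum_s\mu_s\big(\theta_s+\lambda_s^\top(x-x_s)\big):\sum_s\mu_sq_s\le q,\ \sum_s\mu_s=1\Big\},\qquad \underline\lambda=\sum_s\mu_s^*\lambda_s\ (\mu^*\text{ an optimal }\mu),$$ $$\overline\theta=\min_{\mu\ge0}\Big\{\sum_s\mu_s\big(\theta_s+\phi_s^\top(q-q_s)\big):\sum_s\mu_sx_s\le x,\ \sum_s\mu_s=1\Big\}.$$ $\mathcal S$ always contains the entry from a special point $(\underline x^O,\underline q)$ with $\underline x^O\le x_i^O$ for every $x_i^O$ considered and $\underline q\le q_i$ for all $i$ (componentwise). Under the convexity, concavity and monotonicity hypotheses on $g$, it is known that, when called at $(\hat x^O_{ij},q_i)$ and returning $\underline\theta_{ij},\overline\theta_{ij},\underline\lambda_{ij}$, the oracles satisfy $\underline\theta_{ij}+\underline\lambda_{ij}^\top(x_i^O-\hat x_{ij}^O)\le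 g(x_i^O,q_i)$ for all $x_i^O$, and $g(\hat x^O_{ij},q_i)\le\overline\theta_{ij}$. **Reduced master problem (RMP) at iteration $j$.** Minimise $\sum_i\pi_i(c_i^\top x_i+\beta_i)$ over $\mathbf x\in\mathcal X$ satisfying the strategic constraints in $(S)$ and $\beta_i\ge\underline\beta$, subject to $\beta_i\ge\underline\theta_{ik}+\underline\lambda_{ik}^\top(x_i^O-\hat x_{ik}^O)$ for $i\in\mathcal I$, $k<j$, where $\underline\beta$ is a lower bound on all subproblem values. **Centred point problem (CP) at iteration $j$ with target $T_j$.** Find a (well-centred) point of the polyhedron given by the RMP constraints with integrality relaxed, together with $\sum_i\pi_i(c_i^\top x_i+\beta_i)\le T_j$. **The Algorithm.** Choose $\epsilon>0$, $\gamma_0\in(0,1)$, $\underline\beta$, $\epsilon^0$, $\omega\in(0,1)$, $\underline P\in(0,1)$, $\overline P\in(\underline P,1)$. Set $U^*_0=+\infty$, $\xi=0$, $\mathbf x^{CP}_0=0$, $j=0$. Solve the subproblem exactly at $(\underline x^O,\underline q)$ and initialise $\mathcal S$ with the result. Repeat the following outer iteration: 1. $j:=j+1$. Solve the RMP, obtaining $\mathbf x_j^{RMP}$ and $\beta_{ij}$. Set $L_j^*:=\sum_i\pi_i(c_i^\top x_{ij}^{RMP}+\beta_{ij})$ and $\hat{\mathbf x}_j:=\mathbf x_j^{RMP}$. 2. If $j\ge2$ and $\xi=1$: set $T_j:=L_j^*+\gamma_j(U^*_{j-1}-L_j^* )$ and solve the CP to obtain $\mathbf x^{CP}_j$; if $\|\mathbf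 x^{CP}_j-\mathbf x^{CP}_{j-1}\|\le\epsilon^0$, set $\hat{\mathbf x}_j:=\mathbf x^{CP}_j$. Otherwise set $\mathbf x^{CP}_j:=\mathbf x^{CP}_{j-1}$. 3. For every $i$, call the oracles at $(\hat x_{ij}^O,q_i)$ to get $\underline\theta_{ij},\overline\theta_{ij},\underline\lambda_{ij}$. Set $\xi:=0$. 4. Inner loop, repeat: (a) if $\max_i\pi_i(\overline\theta_{ij}-\underline\theta_{ij})=0$, exit the inner loop; (b) let $\hat i\in\arg\max_i\pi_i(\overline\theta_{ij}-\underline\theta_{ij})$ and solve subproblem $\hat i$ exactly at $(\hat x^O_{\hat ij},q_{\hat i})$, obtaining $\theta_{\hat ij},\lambda_{\hat ij},\phi_{\hat ij}$; (c) if $\theta_{\hat ij}>\underline\theta_{\hat ij}$, set $\xi:=1$; (d) add $(\hat x^O_{\hat ij},q_{\hat i},\theta_{\hat ij},\lambda_{\hat ij},\phi_{\hat ij})$ to $\mathcal S$; (e) for every $i$ call the oracles again at $(\hat x^O_{ij},q_i)$ and update $\underline\theta_{ij},\overline\theta_{ij},\underline\lambda_{ij}$; (f) set $\hat L_j:=\sum_i\pi_i(c_i^\top\hat x_{ij}+\underline\theta_{ij})$, $\hat U_j:=\sum_i\pi_i(c_i^\top\hat x_{ij}+\overline\theta_{ij})$; until ($\hat U_j-\hat L_j\le U^*_{j-1}-L^*_{j-1}$ and $\xi=1$) or $\hat L_j\ge U^*_{j-1}$. (For $j=1$ the first inequality counts as true since $U_0^*=+\infty$.) 5. For every $i$ call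 the upper bound oracle at $(x_{ij}^{RMP,O},q_i)$ to obtain $\overline\theta_{ij}$. Set $U_j:=\sum_i\pi_i(c_i^\top x^{RMP}_{ij}+\overline\theta_{ij})$ and $U_j^*:=\min(U^*_{j-1},U_j)$. 6. Level adjustment: $I^P_j:=\hat L_{j-1}-T_j$, $I^A_j:=\hat L_{j-1}-\hat L_j$, $r:=I^A_j/I^P_j$. If $I^A_j>0$ and $I^P_j>0$: set $\gamma_{j+1}:=1-\omega(1-\gamma_j)$ if $r\le\underline P$, and $\gamma_{j+1}:=\omega\gamma_j$ if $r>\overline P$. In all other cases (including when these quantities are undefined) $\gamma$ is unchanged. Stop when $U_j^*-L_j^*\le\epsilon$. The solution obtained is the incumbent, i.e. the point $\mathbf x_k^{RMP}$ with $U_k=U_j^*$. *)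

theory Defs
  imports "HOL-Analysis.Analysis"
begin

section \<open>The multi-horizon stochastic program\<close>

text \<open>
  The dimension of \<open>x\<^sub>i\<close> and the number of strategic constraint rows may vary with the node \<open>i\<close>,
  so strategic vectors and matrices are indexed by natural numbers below \<open>dimx P i\<close> and
  \<open>rows P i\<close>; entries outside these ranges are never used.  The subproblem data do not depend
  on the node, so their dimensions are types.  Bounds are extended reals: infinite means absent.
\<close>

type_synonym 'i point = "'i \<Rightarrow> nat \<Rightarrow> real"

record ('i, 'o, 'p, 'y, 'r) mhsp =
  nodes :: "'i set"
  root_node :: 'i
  anc :: "'i \<Rightarrow> 'i"
  prob :: "'i \<Rightarrow> real"
  dimx :: "'i \<Rightarrow> nat"
  rows :: "'i \<Rightarrow> nat"
  cost :: "'i \<Rightarrow> nat \<Rightarrow> real"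
  TI :: "'i \<Rightarrow> nat \<Rightarrow> nat \<Rightarrow> real"
  WI :: "'i \<Rightarrow> nat \<Rightarrow> nat \<Rightarrow> real"
  hI :: "'i \<Rightarrow> nat \<Rightarrow> real"
  xlo :: "'i \<Rightarrow> nat \<Rightarrow> ereal"
  xup :: "'i \<Rightarrow> nat \<Rightarrow> ereal"
  intcomp :: "'i \<Rightarrow> nat set"
  sel :: "'i \<Rightarrow> 'o \<Rightarrow> nat"
  qvec :: "'i \<Rightarrow> real ^ 'p"
  Qmat :: "real ^ 'y ^ 'p"
  TO :: "real ^ 'o ^ 'r"
  WO :: "real ^ 'y ^ 'r"
  hO :: "real ^ 'r"
  ylo :: "'y \<Rightarrow> ereal"
  yup :: "'y \<Rightarrow> ereal"

definition stage ::
  "('i, 'o::finite, 'p::finite, 'y::finite, 'r::finite) mhsp \<Rightarrow> 'i \<Rightarrow> nat" where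
  "stage P i = (LEAST k. (anc P ^^ k) i = root_node P)"

text \<open>\<open>sel P i\<close> lists the positions of the components of \<open>x\<^sub>i\<close> that form the subvector \<open>x\<^sub>i\<^sup>O\<close>.\<close>

definition wf_mhsp ::
  "('i, 'o::finite, 'p::finite, 'y::finite, 'r::finite) mhsp \<Rightarrow> bool" where
  "wf_mhsp P \<longleftrightarrow>
     finite (nodes P) \<and> root_node P \<in> nodes P \<and>
     (\<forall>i\<in>nodes P - {root_node P}. anc P i \<in> nodes P) \<and>
     (\<forall>i\<in>nodes P. \<exists>k. (anc P ^^ k) i = root_node P) \<and>
     (\<forall>i\<in>nodes P. 0 \<le> prob P i) \<and>
     (\<forall>t\<in>stage P ` nodes P. (\<Sum>i | i \<in> nodes P \<and> stage P i = t. prob P i) = 1) \<and>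
     (\<forall>i\<in>nodes P. inj (sel P i) \<and> range (sel P i) \<subseteq> {..<dimx P i})"

definition lincost ::
  "('i, 'o::finite, 'p::finite, 'y::finite, 'r::finite) mhsp \<Rightarrow> 'i \<Rightarrow> 'i point \<Rightarrow> real" where
  "lincost P i x = (\<Sum>k<dimx P i. cost P i k * x i k)"

definition subvec ::
  "('i, 'o::finite, 'p::finite, 'y::finite, 'r::finite) mhsp \<Rightarrow> 'i point \<Rightarrow> 'i \<Rightarrow> real ^ 'o" where
  "subvec P x i = (\<chi> k. x i (sel P i k))"

definition strategic ::
  "('i, 'o::finite, 'p::finite, 'y::finite, 'r::finite) mhsp \<Rightarrow> 'i point \<Rightarrow> bool" where
  "strategic P x \<longleftrightarrow>
     (\<forall>i\<in>nodes P - {root_node P}. \<forall>r<rows P i.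
        (\<Sum>k<dimx P (anc P i). TI P (anc P i) r k * x (anc P i) k)
        + (\<Sum>k<dimx P i. WI P i r k * x i k) \<le> hI P i r) \<and>
     (\<forall>r<rows P (root_node P).
        (\<Sum>k<dimx P (root_node P). WI P (root_node P) r k * x (root_node P) k)
        \<le> hI P (root_node P) r)"

definition in_bounds ::
  "('i, 'o::finite, 'p::finite, 'y::finite, 'r::finite) mhsp \<Rightarrow> 'i point \<Rightarrow> bool" where
  "in_bounds P x \<longleftrightarrow> (\<forall>i\<in>nodes P. \<forall>k<dimx P i. xlo P i k \<le> x i k \<and> x i k \<le> xup P i k)"

definition integral_comps ::
  "('i, 'o::finite, 'p::finite, 'y::finite, 'r::finite) mhsp \<Rightarrow> 'i point \<Rightarrow> bool" where
  "integral_comps P x \<longleftrightarrow> (\<forall>i\<in>nodes P. \<forall>k<dimx P i. k \<in> intcomp P i \<longrightarrow> x i k \<in> \<int>)"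

definition relaxed ::
  "('i, 'o::finite, 'p::finite, 'y::finite, 'r::finite) mhsp \<Rightarrow> 'i point set" where
  "relaxed P = {x. in_bounds P x \<and> strategic P x}"

definition feasible ::
  "('i, 'o::finite, 'p::finite, 'y::finite, 'r::finite) mhsp \<Rightarrow> 'i point set" where
  "feasible P = {x. in_bounds P x \<and> integral_comps P x \<and> strategic P x}"

definition sub_feasible ::
  "('i, 'o::finite, 'p::finite, 'y::finite, 'r::finite) mhsp \<Rightarrow> real ^ 'o
     \<Rightarrow> (real ^ 'y) set" where
  "sub_feasible P x =
     {y. (\<forall>k. ylo P k \<le> y $ k \<and> y $ k \<le> yup P k) \<and> TO P *v x + WO P *v y \<le> hO P}"

definition sub_finite ::
  "('i, 'o::finite, 'p::finite, 'y::finite, 'r::finite) mhsp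
     \<Rightarrow> real ^ 'o \<Rightarrow> real ^ 'p \<Rightarrow> bool" where
  "sub_finite P x q \<longleftrightarrow>
     sub_feasible P x \<noteq> {} \<and> bdd_below ((\<lambda>y. q \<bullet> (Qmat P *v y)) ` sub_feasible P x)"

text \<open>The optimal value of subproblem \<open>(x, q)\<close>; meaningful only where \<open>sub_finite P x q\<close> holds
  (the infimum of a linear program is then attained).\<close>

definition gval ::
  "('i, 'o::finite, 'p::finite, 'y::finite, 'r::finite) mhsp
     \<Rightarrow> real ^ 'o \<Rightarrow> real ^ 'p \<Rightarrow> real" where
  "gval P x q = (INF y\<in>sub_feasible P x. q \<bullet> (Qmat P *v y))"

definition objective ::
  "('i, 'o::finite, 'p::finite, 'y::finite, 'r::finite) mhsp \<Rightarrow> 'i point \<Rightarrow> real" where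
  "objective P x = (\<Sum>i\<in>nodes P. prob P i * (lincost P i x + gval P (subvec P x i) (qvec P i)))"

definition eps_optimal ::
  "('i, 'o::finite, 'p::finite, 'y::finite, 'r::finite) mhsp
     \<Rightarrow> real \<Rightarrow> 'i point \<Rightarrow> bool" where
  "eps_optimal P e x \<longleftrightarrow>
     x \<in> feasible P \<and> objective P x \<le> (INF x'\<in>feasible P. objective P x') + e"


section \<open>Adaptive oracles\<close>

record ('o, 'p) entry =
  entry_x :: "real ^ 'o"
  entry_q :: "real ^ 'p"
  entry_theta :: real
  entry_lam :: "real ^ 'o"
  entry_phi :: "real ^ 'p"

text \<open>
  The subgradient and supergradient inequalities range over the points where the subproblem has
  a finite value.  Elsewhere they carry no information: \<open>g\<close> is \<open>+\<infinity>\<close> at an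
  infeasible \<open>x'\<close>, and \<open>-\<infinity>\<close> at a \<open>q'\<close> for which the subproblem is unbounded.
\<close>

definition exact_solution ::
  "('i, 'o::finite, 'p::finite, 'y::finite, 'r::finite) mhsp
     \<Rightarrow> real ^ 'o \<Rightarrow> real ^ 'p \<Rightarrow> ('o, 'p) entry \<Rightarrow> bool" where
  "exact_solution P x q s \<longleftrightarrow>
     entry_x s = x \<and> entry_q s = q \<and> entry_theta s = gval P x q \<and>
     (\<forall>x'. sub_finite P x' q \<longrightarrow> gval P x q + entry_lam s \<bullet> (x' - x) \<le> gval P x' q) \<and>
     (\<forall>q'. sub_finite P x q' \<longrightarrow> gval P x q' \<le> gval P x q + entry_phi s \<bullet> (q' - q))"

definition lower_oracle ::
  "('o::finite, 'p::finite) entry set \<Rightarrow> real ^ 'o \<Rightarrow> real ^ 'p \<Rightarrow> real \<Rightarrow> real ^ 'o \<Rightarrow> bool" where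
  "lower_oracle S x q th lam \<longleftrightarrow>
     (\<exists>\<mu>. is_arg_max (\<lambda>\<mu>. \<Sum>s\<in>S. \<mu> s * (entry_theta s + entry_lam s \<bullet> (x - entry_x s)))
            (\<lambda>\<mu>. (\<forall>s\<in>S. 0 \<le> \<mu> s) \<and> (\<Sum>s\<in>S. \<mu> s *\<^sub>R entry_q s) \<le> q \<and> (\<Sum>s\<in>S. \<mu> s) = 1) \<mu> \<and>
          th = (\<Sum>s\<in>S. \<mu> s * (entry_theta s + entry_lam s \<bullet> (x - entry_x s))) \<and>
          lam = (\<Sum>s\<in>S. \<mu> s *\<^sub>R entry_lam s))"

definition upper_oracle ::
  "('o::finite, 'p::finite) entry set \<Rightarrow> real ^ 'o \<Rightarrow> real ^ 'p \<Rightarrow> real \<Rightarrow> bool" where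
  "upper_oracle S x q th \<longleftrightarrow>
     (\<exists>\<mu>. is_arg_min (\<lambda>\<mu>. \<Sum>s\<in>S. \<mu> s * (entry_theta s + entry_phi s \<bullet> (q - entry_q s)))
            (\<lambda>\<mu>. (\<forall>s\<in>S. 0 \<le> \<mu> s) \<and> (\<Sum>s\<in>S. \<mu> s *\<^sub>R entry_x s) \<le> x \<and> (\<Sum>s\<in>S. \<mu> s) = 1) \<mu> \<and>
          th = (\<Sum>s\<in>S. \<mu> s * (entry_theta s + entry_phi s \<bullet> (q - entry_q s))))"


section \<open>The stabilised adaptive Benders algorithm\<close>

record ('o, 'p) params =
  eps :: real
  gamma0 :: real
  beta_lo :: real
  eps0 :: real
  omega :: real
  P_lo :: real
  P_up :: real
  x_special :: "real ^ 'o"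
  q_special :: "real ^ 'p"

definition valid_params :: "('o::finite, 'p::finite) params \<Rightarrow> bool" where
  "valid_params A \<longleftrightarrow>
     0 < eps A \<and> 0 < gamma0 A \<and> gamma0 A < 1 \<and> 0 < omega A \<and> omega A < 1 \<and>
     0 < P_lo A \<and> P_lo A < 1 \<and> P_lo A < P_up A \<and> P_up A < 1"

text \<open>
  The algorithm makes choices (among optimal solutions, weights, subgradients, centred points),
  so it is described by a predicate on its execution traces.  Index \<open>j\<close> of each component
  is the value at the end of outer iteration \<open>j\<close>; index 0 is the initial value.  Exceptionally,
  \<open>gam\<close> at index \<open>j\<close> is the \<open>\<gamma>\<close> used in iteration \<open>j\<close>, computed in iteration \<open>j - 1\<close>.
  Quantities that some iterations do not compute are options.
\<close>

record ('i, 'o, 'p) trace =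
  xRMP :: "nat \<Rightarrow> 'i point"
  beta :: "nat \<Rightarrow> 'i \<Rightarrow> real"
  Lstar :: "nat \<Rightarrow> real"
  target :: "nat \<Rightarrow> real option"
  xCP :: "nat \<Rightarrow> 'i point"
  xhat :: "nat \<Rightarrow> 'i point"
  entries :: "nat \<Rightarrow> ('o, 'p) entry set"
  th_lo :: "nat \<Rightarrow> 'i \<Rightarrow> real"
  lam_lo :: "nat \<Rightarrow> 'i \<Rightarrow> real ^ 'o"
  xi :: "nat \<Rightarrow> bool"
  Lhat :: "nat \<Rightarrow> real option"
  Uval :: "nat \<Rightarrow> real"
  Ustar :: "nat \<Rightarrow> ereal"
  gam :: "nat \<Rightarrow> real"

definition master_obj ::
  "('i, 'o::finite, 'p::finite, 'y::finite, 'r::finite) mhsp \<Rightarrow> 'i point \<Rightarrow> ('i \<Rightarrow> real) \<Rightarrow> real" where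
  "master_obj P x b = (\<Sum>i\<in>nodes P. prob P i * (lincost P i x + b i))"

definition cuts ::
  "('i, 'o::finite, 'p::finite, 'y::finite, 'r::finite) mhsp \<Rightarrow> ('o, 'p) params \<Rightarrow> ('i, 'o, 'p) trace
     \<Rightarrow> nat \<Rightarrow> 'i point \<Rightarrow> ('i \<Rightarrow> real) \<Rightarrow> bool" where
  "cuts P A tr j x b \<longleftrightarrow>
     (\<forall>i\<in>nodes P. beta_lo A \<le> b i \<and>
        (\<forall>k\<in>{1..<j}. th_lo tr k i + lam_lo tr k i \<bullet> (subvec P x i - subvec P (xhat tr k) i) \<le> b i))"

definition solves_RMP ::
  "('i, 'o::finite, 'p::finite, 'y::finite, 'r::finite) mhsp \<Rightarrow> ('o, 'p) params \<Rightarrow> ('i, 'o, 'p) trace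
     \<Rightarrow> nat \<Rightarrow> 'i point \<Rightarrow> ('i \<Rightarrow> real) \<Rightarrow> bool" where
  "solves_RMP P A tr j x b \<longleftrightarrow>
     is_arg_min (\<lambda>(x, b). master_obj P x b) (\<lambda>(x, b). x \<in> feasible P \<and> cuts P A tr j x b) (x, b)"

text \<open>Any point of the polyhedron is admitted as the answer of the centred point problem.\<close>

definition solves_CP ::
  "('i, 'o::finite, 'p::finite, 'y::finite, 'r::finite) mhsp \<Rightarrow> ('o, 'p) params \<Rightarrow> ('i, 'o, 'p) trace
     \<Rightarrow> nat \<Rightarrow> real \<Rightarrow> 'i point \<Rightarrow> bool" where
  "solves_CP P A tr j t x \<longleftrightarrow>
     (\<exists>b. x \<in> relaxed P \<and> cuts P A tr j x b \<and> master_obj P x b \<le> t)"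

definition pdist ::
  "('i, 'o::finite, 'p::finite, 'y::finite, 'r::finite) mhsp \<Rightarrow> 'i point \<Rightarrow> 'i point \<Rightarrow> real" where
  "pdist P x x' = L2_set (\<lambda>(i, k). x i k - x' i k) (SIGMA i:nodes P. {..<dimx P i})"

record ('i, 'o, 'p) inner_state =
  st_entries :: "('o, 'p) entry set"
  st_lo :: "'i \<Rightarrow> real"
  st_lam :: "'i \<Rightarrow> real ^ 'o"
  st_up :: "'i \<Rightarrow> real"
  st_xi :: bool
  st_L :: "real option"
  st_U :: "real option"

definition call_oracles ::
  "('i, 'o::finite, 'p::finite, 'y::finite, 'r::finite) mhsp \<Rightarrow> 'i point
     \<Rightarrow> ('i, 'o, 'p) inner_state \<Rightarrow> bool" where
  "call_oracles P x c \<longleftrightarrow>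
     (\<forall>i\<in>nodes P.
        lower_oracle (st_entries c) (subvec P x i) (qvec P i) (st_lo c i) (st_lam c i) \<and>
        upper_oracle (st_entries c) (subvec P x i) (qvec P i) (st_up c i))"

definition gap ::
  "('i, 'o::finite, 'p::finite, 'y::finite, 'r::finite) mhsp \<Rightarrow> ('i, 'o, 'p) inner_state \<Rightarrow> 'i \<Rightarrow> real" where
  "gap P c i = prob P i * (st_up c i - st_lo c i)"

definition inner_done ::
  "('i, 'o::finite, 'p::finite, 'y::finite, 'r::finite) mhsp \<Rightarrow> ('i, 'o, 'p) inner_state \<Rightarrow> bool" where
  "inner_done P c \<longleftrightarrow> Max (gap P c ` nodes P) = 0"

definition inner_pass ::
  "('i, 'o::finite, 'p::finite, 'y::finite, 'r::finite) mhsp \<Rightarrow> 'i point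
     \<Rightarrow> ('i, 'o, 'p) inner_state \<Rightarrow> ('i, 'o, 'p) inner_state \<Rightarrow> bool" where
  "inner_pass P x c c' \<longleftrightarrow>
     (\<exists>i s. is_arg_max (gap P c) (\<lambda>i. i \<in> nodes P) i \<and>
        exact_solution P (subvec P x i) (qvec P i) s \<and>
        st_xi c' = (st_xi c \<or> entry_theta s > st_lo c i) \<and>
        st_entries c' = insert s (st_entries c) \<and>
        call_oracles P x c' \<and>
        st_L c' = Some (master_obj P x (st_lo c')) \<and>
        st_U c' = Some (master_obj P x (st_up c')))"

text \<open>In the first outer iteration \<open>Uprev = \<infinity>\<close>, so the first inequality below holds
  whatever the value of \<open>Lprev\<close>.\<close>

definition inner_until :: "ereal \<Rightarrow> real \<Rightarrow> ('i, 'o::finite, 'p::finite) inner_state \<Rightarrow> bool" where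
  "inner_until Uprev Lprev c \<longleftrightarrow>
     ereal (the (st_U c) - the (st_L c)) \<le> Uprev - ereal Lprev \<and> st_xi c
     \<or> Uprev \<le> ereal (the (st_L c))"

inductive inner_loop ::
  "('i, 'o::finite, 'p::finite, 'y::finite, 'r::finite) mhsp \<Rightarrow> 'i point
     \<Rightarrow> ereal \<Rightarrow> real \<Rightarrow> ('i, 'o, 'p) inner_state \<Rightarrow> ('i, 'o, 'p) inner_state \<Rightarrow> bool"
  for P x Uprev Lprev where
  exit: "inner_done P c \<Longrightarrow> inner_loop P x Uprev Lprev c c"
| last: "\<not> inner_done P c \<Longrightarrow> inner_pass P x c c' \<Longrightarrow> inner_until Uprev Lprev c'
         \<Longrightarrow> inner_loop P x Uprev Lprev c c'"
| again: "\<not> inner_done P c \<Longrightarrow> inner_pass P x c c' \<Longrightarrow> \<not> inner_until Uprev Lprev c'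
         \<Longrightarrow> inner_loop P x Uprev Lprev c' c'' \<Longrightarrow> inner_loop P x Uprev Lprev c c''"

definition initialised ::
  "('i, 'o::finite, 'p::finite, 'y::finite, 'r::finite) mhsp \<Rightarrow> ('o, 'p) params
     \<Rightarrow> ('i, 'o, 'p) trace \<Rightarrow> bool" where
  "initialised P A tr \<longleftrightarrow>
     Ustar tr 0 = \<infinity> \<and> \<not> xi tr 0 \<and> xCP tr 0 = (\<lambda>i k. 0) \<and> Lhat tr 0 = None \<and>
     gam tr 1 = gamma0 A \<and>
     (\<exists>s. exact_solution P (x_special A) (q_special A) s \<and> entries tr 0 = {s})"

definition step_RMP ::
  "('i, 'o::finite, 'p::finite, 'y::finite, 'r::finite) mhsp \<Rightarrow> ('o, 'p) params \<Rightarrow> ('i, 'o, 'p) trace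
     \<Rightarrow> nat \<Rightarrow> bool" where
  "step_RMP P A tr j \<longleftrightarrow>
     solves_RMP P A tr j (xRMP tr j) (beta tr j) \<and>
     Lstar tr j = master_obj P (xRMP tr j) (beta tr j)"

definition step_CP ::
  "('i, 'o::finite, 'p::finite, 'y::finite, 'r::finite) mhsp \<Rightarrow> ('o, 'p) params \<Rightarrow> ('i, 'o, 'p) trace
     \<Rightarrow> nat \<Rightarrow> bool" where
  "step_CP P A tr j \<longleftrightarrow>
     (if j \<ge> 2 \<and> xi tr (j - 1) then
        (let t = Lstar tr j + gam tr j * (real_of_ereal (Ustar tr (j - 1)) - Lstar tr j) in
           target tr j = Some t \<and> solves_CP P A tr j t (xCP tr j) \<and>
           xhat tr j =
             (if pdist P (xCP tr j) (xCP tr (j - 1)) \<le> eps0 A then xCP tr j else xRMP tr j))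
      else target tr j = None \<and> xCP tr j = xCP tr (j - 1) \<and> xhat tr j = xRMP tr j)"

definition step_oracles ::
  "('i, 'o::finite, 'p::finite, 'y::finite, 'r::finite) mhsp
     \<Rightarrow> ('i, 'o, 'p) trace \<Rightarrow> nat \<Rightarrow> bool" where
  "step_oracles P tr j \<longleftrightarrow>
     (\<exists>c c'. st_entries c = entries tr (j - 1) \<and> \<not> st_xi c \<and> st_L c = None \<and> st_U c = None \<and>
        call_oracles P (xhat tr j) c \<and>
        inner_loop P (xhat tr j) (Ustar tr (j - 1)) (Lstar tr (j - 1)) c c' \<and>
        entries tr j = st_entries c' \<and> th_lo tr j = st_lo c' \<and> lam_lo tr j = st_lam c' \<and>
        xi tr j = st_xi c' \<and> Lhat tr j = st_L c')"

definition step_upper ::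
  "('i, 'o::finite, 'p::finite, 'y::finite, 'r::finite) mhsp \<Rightarrow> ('i, 'o, 'p) trace \<Rightarrow> nat \<Rightarrow> bool" where
  "step_upper P tr j \<longleftrightarrow>
     (\<exists>th. (\<forall>i\<in>nodes P.
              upper_oracle (entries tr j) (subvec P (xRMP tr j) i) (qvec P i) (th i)) \<and>
        Uval tr j = master_obj P (xRMP tr j) th) \<and>
     Ustar tr j = min (Ustar tr (j - 1)) (ereal (Uval tr j))"

definition step_level ::
  "('o::finite, 'p::finite) params \<Rightarrow> ('i, 'o, 'p) trace \<Rightarrow> nat \<Rightarrow> bool" where
  "step_level A tr j \<longleftrightarrow>
     gam tr (Suc j) =
       (case (Lhat tr (j - 1), target tr j, Lhat tr j) of
          (Some l', Some t, Some l) \<Rightarrow>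
            (let IP = l' - t; IA = l' - l; r = IA / IP in
               if IA > 0 \<and> IP > 0 \<and> r \<le> P_lo A then 1 - omega A * (1 - gam tr j)
               else if IA > 0 \<and> IP > 0 \<and> r > P_up A then omega A * gam tr j
               else gam tr j)
        | _ \<Rightarrow> gam tr j)"

definition iteration ::
  "('i, 'o::finite, 'p::finite, 'y::finite, 'r::finite) mhsp \<Rightarrow> ('o, 'p) params
     \<Rightarrow> ('i, 'o, 'p) trace \<Rightarrow> nat \<Rightarrow> bool" where
  "iteration P A tr j \<longleftrightarrow>
     step_RMP P A tr j \<and> step_CP P A tr j \<and> step_oracles P tr j \<and> step_upper P tr j \<and>
     step_level A tr j"

definition stops ::
  "('o::finite, 'p::finite) params \<Rightarrow> ('i, 'o, 'p) trace \<Rightarrow> nat \<Rightarrow> bool" where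
  "stops A tr j \<longleftrightarrow> Ustar tr j - ereal (Lstar tr j) \<le> ereal (eps A)"

definition terminates_at ::
  "('i, 'o::finite, 'p::finite, 'y::finite, 'r::finite) mhsp \<Rightarrow> ('o, 'p) params
     \<Rightarrow> ('i, 'o, 'p) trace \<Rightarrow> nat \<Rightarrow> bool" where
  "terminates_at P A tr J \<longleftrightarrow>
     J \<ge> 1 \<and> initialised P A tr \<and> (\<forall>j\<in>{1..J}. iteration P A tr j) \<and>
     (\<forall>j\<in>{1..<J}. \<not> stops A tr j) \<and> stops A tr J"

definition incumbent ::
  "('i, 'o::finite, 'p::finite) trace \<Rightarrow> nat \<Rightarrow> 'i point \<Rightarrow> bool" where
  "incumbent tr J x \<longleftrightarrow> (\<exists>k\<in>{1..J}. ereal (Uval tr k) = Ustar tr J \<and> x = xRMP tr k)"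

text \<open>The points \<open>x\<close> whose subvectors are considered: those at which the objective is defined by
  the program itself, and those visited by the run (centred points need not be integral).\<close>

definition considered ::
  "('i, 'o::finite, 'p::finite, 'y::finite, 'r::finite) mhsp \<Rightarrow> ('i, 'o, 'p) trace \<Rightarrow> nat \<Rightarrow> 'i point set" where
  "considered P tr J = feasible P \<union> xhat tr ` {1..J}"

end

theory Submission
  imports Defs
begin

text \<open>
  The algorithm is a cutting-plane scheme, so it suffices that every cut of the master problem
  underestimates the subproblem values \<open>g(x, q) = gval P x q\<close> at all feasible points and every
  \<open>Uval\<close> overestimates the objective at the master solution it belongs to: then at termination the optimal
  value is at least the master value \<open>Lstar tr J\<close>, the cost of the incumbent is at most
  \<open>Ustar tr J\<close>, and the stopping test bounds the difference of the two by the tolerance.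

  Both facts come from the same averaging argument.  A stored entry solves the subproblem at
  \<open>(x\<^sub>s, q\<^sub>s)\<close>, and its subgradient bounds \<open>g(x, q\<^sub>s)\<close> from below at every \<open>x\<close> of the
  domain.  Averaging such bounds with weights \<open>\<mu>\<close> that add up to one gives
  \<open>\<Sum>\<^sub>s \<mu>\<^sub>s (\<theta>\<^sub>s + \<lambda>\<^sub>s \<bullet> (x - x\<^sub>s)) \<le> \<Sum>\<^sub>s \<mu>\<^sub>s g(x, q\<^sub>s) \<le> g(x, \<Sum>\<^sub>s \<mu>\<^sub>s q\<^sub>s) \<le> g(x, q)\<close>,
  where the second step is concavity in \<open>q\<close> and the third monotonicity in \<open>q\<close>, available because the
  oracle only uses weights with \<open>\<Sum>\<^sub>s \<mu>\<^sub>s q\<^sub>s \<le> q\<close> (\<open>lower_oracle_cut\<close>).  Exchanging the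
  roles of \<open>x\<close> and \<open>q\<close>, and of sub- and supergradients, gives the upper bound
  (\<open>upper_oracle_bound\<close>).

  The cut is valid on the whole domain whatever point the oracle was called at.  This is what
  makes stabilisation safe: a cut generated at a centred point, possibly fractional, still
  underestimates the subproblem values of all feasible points.  The invariant behind both bounds is
  that the collection of entries remains finite and consists of exact solutions at points of the
  domain (\<open>valid_entries\<close>).
\<close>

section \<open>Validity of the adaptive oracles\<close>

definition valid_entries ::
  "('i, 'o::finite, 'p::finite, 'y::finite, 'r::finite) mhsp
     \<Rightarrow> (real ^ 'o) set \<Rightarrow> (real ^ 'p) set \<Rightarrow> ('o, 'p) entry set \<Rightarrow> bool" where
  "valid_entries P DX DQ S \<longleftrightarrow>
     finite S \<and>
     (\<forall>s\<in>S. entry_x s \<in> DX \<and> entry_q s \<in> DQ \<and> exact_solution P (entry_x s) (entry_q s) s)"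

lemma exact_solution_at_entry_point:
  assumes "exact_solution P x q s"
  shows "entry_x s = x" "entry_q s = q" "exact_solution P (entry_x s) (entry_q s) s"
  using assms by (auto simp: exact_solution_def)

lemma valid_entries_insert:
  assumes "valid_entries P DX DQ S" "exact_solution P x q s" "x \<in> DX" "q \<in> DQ"
  shows "valid_entries P DX DQ (insert s S)"
  using assms exact_solution_at_entry_point[OF assms(2)] by (auto simp: valid_entries_def)

lemma valid_entries_singleton:
  assumes "exact_solution P x q s" "x \<in> DX" "q \<in> DQ"
  shows "valid_entries P DX DQ {s}"
  using assms exact_solution_at_entry_point[OF assms(1)] by (auto simp: valid_entries_def)

text \<open>
  The call point \<open>x0\<close> cancels from the affine function that the oracle returns, because the
  returned value and slope use the same weights; what remains is the weighted average of the cuts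
  of the individual entries.  This is why a function built for \<open>x0\<close> is a valid cut at \<open>x\<close> too.
\<close>

lemma lower_oracle_cut:
  fixes P :: "('i, 'o::finite, 'p::finite, 'y::finite, 'r::finite) mhsp"
  assumes returned: "lower_oracle S x0 q th lam"
    and entries: "valid_entries P DX DQ S"
    and q: "q \<in> DQ"
    and finite_values: "\<And>q'. q' \<in> DQ \<Longrightarrow> sub_finite P x q'"
    and concave: "concave_on DQ (gval P x)"
    and mono: "mono_on DQ (gval P x)"
  shows "th + lam \<bullet> (x - x0) \<le> gval P x q"
proof -
  obtain \<mu> where nonneg: "\<And>s. s \<in> S \<Longrightarrow> 0 \<le> \<mu> s"
    and below: "(\<Sum>s\<in>S. \<mu> s *\<^sub>R entry_q s) \<le> q" and total: "sum \<mu> S = 1"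
    and th: "th = (\<Sum>s\<in>S. \<mu> s * (entry_theta s + entry_lam s \<bullet> (x0 - entry_x s)))"
    and lam: "lam = (\<Sum>s\<in>S. \<mu> s *\<^sub>R entry_lam s)"
    using returned by (auto simp: lower_oracle_def is_arg_max_def)
  have fin: "finite S" and in_DQ: "\<And>s. s \<in> S \<Longrightarrow> entry_q s \<in> DQ"
    and exact: "\<And>s. s \<in> S \<Longrightarrow> exact_solution P (entry_x s) (entry_q s) s"
    using entries by (auto simp: valid_entries_def)
  have avg_in_DQ: "(\<Sum>s\<in>S. \<mu> s *\<^sub>R entry_q s) \<in> DQ"
    using concave fin total nonneg in_DQ
    by (intro convex_sum) (auto simp: concave_on_def convex_on_def)
  have "th + lam \<bullet> (x - x0) = (\<Sum>s\<in>S. \<mu> s * (entry_theta s + entry_lam s \<bullet> (x - entry_x s)))"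
    unfolding th lam inner_sum_left sum.distrib[symmetric]
    by (intro sum.cong) (auto simp: algebra_simps)
  also have "\<dots> \<le> (\<Sum>s\<in>S. \<mu> s * gval P x (entry_q s))"
  proof (intro sum_mono mult_left_mono nonneg)
    fix s assume s: "s \<in> S"
    show "entry_theta s + entry_lam s \<bullet> (x - entry_x s) \<le> gval P x (entry_q s)"
      using exact[OF s] finite_values[OF in_DQ[OF s]] by (simp add: exact_solution_def)
  qed
  also have "\<dots> \<le> gval P x (\<Sum>s\<in>S. \<mu> s *\<^sub>R entry_q s)"
    using concave_on_sum[of S DQ "gval P x" \<mu> entry_q] concave fin total nonneg in_DQ by fastforce
  also have "\<dots> \<le> gval P x q"
    using mono_onD[OF mono avg_in_DQ q below] .
  finally show ?thesis .
qed

text \<open>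
  Supergradients bound \<open>g(x\<^sub>s, q)\<close> from above at the stored points only.  Convexity passes
  from the weighted average of these bounds to a bound at the averaged point \<open>\<Sum>\<^sub>s \<mu>\<^sub>s x\<^sub>s\<close>,
  and since that point is below \<open>x\<close> and \<open>g\<close> decreases in \<open>x\<close>, to a bound at \<open>x\<close>.
\<close>

lemma upper_oracle_bound:
  fixes P :: "('i, 'o::finite, 'p::finite, 'y::finite, 'r::finite) mhsp"
  assumes returned: "upper_oracle S x q th"
    and entries: "valid_entries P DX DQ S"
    and x: "x \<in> DX"
    and finite_values: "\<And>x'. x' \<in> DX \<Longrightarrow> sub_finite P x' q"
    and convex: "convex_on DX (\<lambda>x. gval P x q)"
    and antimono: "antimono_on DX (\<lambda>x. gval P x q)"
  shows "gval P x q \<le> th"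
proof -
  obtain \<mu> where nonneg: "\<And>s. s \<in> S \<Longrightarrow> 0 \<le> \<mu> s"
    and below: "(\<Sum>s\<in>S. \<mu> s *\<^sub>R entry_x s) \<le> x" and total: "sum \<mu> S = 1"
    and th: "th = (\<Sum>s\<in>S. \<mu> s * (entry_theta s + entry_phi s \<bullet> (q - entry_q s)))"
    using returned by (auto simp: upper_oracle_def is_arg_min_def)
  have fin: "finite S" and in_DX: "\<And>s. s \<in> S \<Longrightarrow> entry_x s \<in> DX"
    and exact: "\<And>s. s \<in> S \<Longrightarrow> exact_solution P (entry_x s) (entry_q s) s"
    using entries by (auto simp: valid_entries_def)
  have avg_in_DX: "(\<Sum>s\<in>S. \<mu> s *\<^sub>R entry_x s) \<in> DX"
    using convex fin total nonneg in_DX by (intro convex_sum) (auto simp: convex_on_def)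
  have "gval P x q \<le> gval P (\<Sum>s\<in>S. \<mu> s *\<^sub>R entry_x s) q"
    using monotone_onD[OF antimono avg_in_DX x below] .
  also have "\<dots> \<le> (\<Sum>s\<in>S. \<mu> s * gval P (entry_x s) q)"
    using convex_on_sum[of S DX "\<lambda>x. gval P x q" \<mu> entry_x] convex fin total nonneg in_DX
    by fastforce
  also have "\<dots> \<le> th"
    unfolding th
  proof (intro sum_mono mult_left_mono nonneg)
    fix s assume s: "s \<in> S"
    show "gval P (entry_x s) q \<le> entry_theta s + entry_phi s \<bullet> (q - entry_q s)"
      using exact[OF s] finite_values[OF in_DX[OF s]] by (simp add: exact_solution_def)
  qed
  finally show ?thesis .
qed

section \<open>What a run preserves\<close>

text \<open>
  Every way out of the inner loop, including the exit before any pass, leaves the returned bounds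
  as genuine answers of the oracles for the final collection of entries.
\<close>

lemma inner_loop_preserves:
  assumes "inner_loop P x Uprev Lprev c c'"
    and "valid_entries P DX DQ (st_entries c)" "call_oracles P x c"
    and "\<And>i. i \<in> nodes P \<Longrightarrow> subvec P x i \<in> DX" "\<And>i. i \<in> nodes P \<Longrightarrow> qvec P i \<in> DQ"
  shows "valid_entries P DX DQ (st_entries c') \<and> call_oracles P x c'"
proof -
  have pass: "valid_entries P DX DQ (st_entries d') \<and> call_oracles P x d'"
    if "inner_pass P x d d'" "valid_entries P DX DQ (st_entries d)" for d d'
    using that assms(4,5)
    by (auto simp: inner_pass_def is_arg_max_def intro!: valid_entries_insert)
  show ?thesis
    using assms(1-3) by induction (use pass in auto)
qed

text \<open>
  Since \<open>Ustar\<close> starts at infinity, its running minimum is attained by an iteration of the run,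
  so an incumbent exists.
\<close>

lemma Ustar_is_Uval:
  assumes "1 \<le> J" "Ustar tr 0 = \<infinity>" "\<And>j. j \<in> {1..J} \<Longrightarrow> step_upper P tr j"
  shows "\<exists>k\<in>{1..J}. ereal (Uval tr k) = Ustar tr J"
  using assms
proof (induction J rule: nat_induct_at_least)
  case base
  then show ?case by (auto simp: step_upper_def)
next
  case (Suc J)
  then obtain k where k: "k \<in> {1..J}" "ereal (Uval tr k) = Ustar tr J"
    by (meson atLeastAtMost_iff le_Suc_eq)
  have "Ustar tr (Suc J) = min (Ustar tr J) (ereal (Uval tr (Suc J)))"
    using Suc.prems(2)[of "Suc J"] by (auto simp: step_upper_def)
  then have "Ustar tr (Suc J) = ereal (Uval tr k) \<or> Ustar tr (Suc J) = ereal (Uval tr (Suc J))"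
    using k(2) by (auto simp: min_def)
  then show ?case using k(1) by (metis atLeastAtMost_iff le_SucI le_refl Suc_eq_plus1 le_add2)
qed

lemma objective_eq_master_obj:
  "objective P x = master_obj P x (\<lambda>i. gval P (subvec P x i) (qvec P i))"
  by (simp add: objective_def master_obj_def)

lemma master_obj_mono:
  assumes "\<And>i. i \<in> nodes P \<Longrightarrow> 0 \<le> prob P i" "\<And>i. i \<in> nodes P \<Longrightarrow> b i \<le> b' i"
  shows "master_obj P x b \<le> master_obj P x b'"
  unfolding master_obj_def using assms by (intro sum_mono mult_left_mono) auto

text \<open>
  Choosing the exact subproblem values as \<open>\<beta>\<close> turns \<open>x\<close> into a feasible solution of the master
  problem with the same objective value, so the master problem is a relaxation at \<open>x\<close>.
\<close>

lemma Lstar_le_objective: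
  assumes "step_RMP P A tr j" "x \<in> feasible P"
    and "cuts P A tr j x (\<lambda>i. gval P (subvec P x i) (qvec P i))"
  shows "Lstar tr j \<le> objective P x"
  using assms unfolding step_RMP_def solves_RMP_def is_arg_min_linorder objective_eq_master_obj
  by auto

section \<open>Correctness at termination\<close>

theorem lemma1:
  fixes P :: "('i, 'o::finite, 'p::finite, 'y::finite, 'r::finite) mhsp"
    and A :: "('o, 'p) params"
    and tr :: "('i, 'o, 'p) trace"
    and J :: nat
    and DX :: "(real ^ 'o) set" and DQ :: "(real ^ 'p) set"
  assumes wf: "wf_mhsp P"
    and params: "valid_params A"
    and optimum: "\<exists>x. is_arg_min (objective P) (\<lambda>x. x \<in> feasible P) x"
    and DX_points: "x_special A \<in> DX" "\<And>x i. x \<in> considered P tr J \<Longrightarrow> i \<in> nodes P \<Longrightarrow> subvec P x i \<in> DX"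
    and DQ_points: "q_special A \<in> DQ" "\<And>i. i \<in> nodes P \<Longrightarrow> qvec P i \<in> DQ"
    and finite_values: "\<And>x q. x \<in> DX \<Longrightarrow> q \<in> DQ \<Longrightarrow> sub_finite P x q"
    and special_x: "\<And>x i. x \<in> considered P tr J \<Longrightarrow> i \<in> nodes P \<Longrightarrow> x_special A \<le> subvec P x i"
    and special_q: "\<And>i. i \<in> nodes P \<Longrightarrow> q_special A \<le> qvec P i"
    and beta_lower: "\<And>x i. x \<in> feasible P \<Longrightarrow> i \<in> nodes P
                       \<Longrightarrow> beta_lo A \<le> gval P (subvec P x i) (qvec P i)"
    and g_convex: "\<And>q. q \<in> DQ \<Longrightarrow> convex_on DX (\<lambda>x. gval P x q)"
    and g_concave: "\<And>x. x \<in> DX \<Longrightarrow> concave_on DQ (\<lambda>q. gval P x q)"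
    and g_decreasing: "\<And>q. q \<in> DQ \<Longrightarrow> antimono_on DX (\<lambda>x. gval P x q)"
    and g_increasing: "\<And>x. x \<in> DX \<Longrightarrow> mono_on DQ (\<lambda>q. gval P x q)"
    and terminates: "terminates_at P A tr J"
  shows "(\<exists>x. incumbent tr J x) \<and> (\<forall>x. incumbent tr J x \<longrightarrow> eps_optimal P (eps A) x)"
proof -
  have J: "1 \<le> J" and init: "initialised P A tr"
    and iter: "\<And>j. j \<in> {1..J} \<Longrightarrow> iteration P A tr j" and stop: "stops A tr J"
    using terminates by (auto simp: terminates_at_def)
  have prob_nonneg: "\<And>i. i \<in> nodes P \<Longrightarrow> 0 \<le> prob P i"
    using wf by (auto simp: wf_mhsp_def)
  have xhat_DX: "subvec P (xhat tr j) i \<in> DX" if "j \<in> {1..J}" "i \<in> nodes P" for i j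
    using DX_points(2) that by (auto simp: considered_def)
  have feasible_DX: "subvec P x i \<in> DX" if "x \<in> feasible P" "i \<in> nodes P" for x i
    using DX_points(2) that by (auto simp: considered_def)

  have oracles: "valid_entries P DX DQ (entries tr j) \<and>
      (\<forall>i\<in>nodes P. lower_oracle (entries tr j) (subvec P (xhat tr j) i) (qvec P i)
         (th_lo tr j i) (lam_lo tr j i))"
    if j: "j \<in> {1..J}" and valid: "valid_entries P DX DQ (entries tr (j - 1))" for j
  proof -
    obtain c c' where "st_entries c = entries tr (j - 1)" "call_oracles P (xhat tr j) c"
      and loop: "inner_loop P (xhat tr j) (Ustar tr (j - 1)) (Lstar tr (j - 1)) c c'"
      and c': "entries tr j = st_entries c'" "th_lo tr j = st_lo c'" "lam_lo tr j = st_lam c'"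
      using iter[OF j] by (auto simp: iteration_def step_oracles_def)
    then have "valid_entries P DX DQ (st_entries c') \<and> call_oracles P (xhat tr j) c'"
      using valid xhat_DX[OF j] DQ_points(2) by (intro inner_loop_preserves[OF loop]) auto
    then show ?thesis
      using c' by (auto simp: call_oracles_def)
  qed
  have entries: "valid_entries P DX DQ (entries tr j)" if "j \<le> J" for j
    using that
  proof (induction j)
    case 0
    show ?case
      using init valid_entries_singleton[OF _ DX_points(1) DQ_points(1)]
      by (auto simp: initialised_def)
  next
    case (Suc j)
    then show ?case using oracles[of "Suc j"] by simp
  qed

  have exact_values_satisfy_cuts: "cuts P A tr J x (\<lambda>i. gval P (subvec P x i) (qvec P i))"
    if x: "x \<in> feasible P" for x
    unfolding cuts_def
  proof (intro ballI conjI)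
    fix i k assume i: "i \<in> nodes P" and "k \<in> {1..<J}"
    then have k: "k \<in> {1..J}" and valid: "valid_entries P DX DQ (entries tr (k - 1))"
      using entries by auto
    have "lower_oracle (entries tr k) (subvec P (xhat tr k) i) (qvec P i)
        (th_lo tr k i) (lam_lo tr k i)" "valid_entries P DX DQ (entries tr k)"
      using oracles[OF k valid] i by auto
    then show "th_lo tr k i + lam_lo tr k i \<bullet> (subvec P x i - subvec P (xhat tr k) i)
        \<le> gval P (subvec P x i) (qvec P i)"
      using i feasible_DX[OF x i] DQ_points(2)[OF i] finite_values g_concave g_increasing
      by (intro lower_oracle_cut[where DX = DX and DQ = DQ]) auto
  qed (use beta_lower x in auto)
  have RMP_feasible: "xRMP tr j \<in> feasible P" if "j \<in> {1..J}" for j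
    using iter[OF that]
    by (auto simp: iteration_def step_RMP_def solves_RMP_def is_arg_min_def)
  have Lstar_le: "Lstar tr J \<le> (INF x\<in>feasible P. objective P x)"
  proof (rule cINF_greatest)
    show "feasible P \<noteq> {}"
      using RMP_feasible[of J] J by auto
    show "Lstar tr J \<le> objective P x" if "x \<in> feasible P" for x
      using iter[of J] J Lstar_le_objective[OF _ that exact_values_satisfy_cuts[OF that]]
      by (auto simp: iteration_def)
  qed

  have Uval_ge: "objective P (xRMP tr k) \<le> Uval tr k" if k: "k \<in> {1..J}" for k
  proof -
    obtain th where th: "\<And>i. i \<in> nodes P \<Longrightarrow>
        upper_oracle (entries tr k) (subvec P (xRMP tr k) i) (qvec P i) (th i)"
      and U: "Uval tr k = master_obj P (xRMP tr k) th"
      using iter[OF k] by (auto simp: iteration_def step_upper_def)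
    have "gval P (subvec P (xRMP tr k) i) (qvec P i) \<le> th i" if i: "i \<in> nodes P" for i
      using entries[of k] k feasible_DX[OF RMP_feasible[OF k] i] DQ_points(2)[OF i]
        finite_values g_convex g_decreasing
      by (intro upper_oracle_bound[OF th[OF i], where DX = DX and DQ = DQ]) auto
    then show ?thesis
      unfolding U objective_eq_master_obj by (intro master_obj_mono prob_nonneg)
  qed

  \<comment> \<open>The incumbent need not come from the last iteration: its upper bound \<open>Uval tr k\<close> is compared
    with the master value of iteration \<open>J\<close>, which bounds the optimum from below.\<close>
  have eps_opt: "eps_optimal P (eps A) x" if inc: "incumbent tr J x" for x
  proof -
    obtain k where k: "k \<in> {1..J}" "ereal (Uval tr k) = Ustar tr J" and x: "x = xRMP tr k"
      using inc by (auto simp: incumbent_def)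
    have "Uval tr k \<le> Lstar tr J + eps A"
      using stop unfolding stops_def k(2)[symmetric] by simp
    then have "objective P x \<le> (INF x'\<in>feasible P. objective P x') + eps A"
      using Uval_ge[OF k(1)] Lstar_le x by simp
    then show ?thesis
      using RMP_feasible[OF k(1)] x by (simp add: eps_optimal_def)
  qed
  moreover have "\<exists>k\<in>{1..J}. ereal (Uval tr k) = Ustar tr J"
    using J init iter by (intro Ustar_is_Uval[of J tr P]) (auto simp: initialised_def iteration_def)
  ultimately show ?thesis
    by (auto simp: incumbent_def)
qed

end
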